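(* Let $t\ge 2$ be a fixed integer. Then, as $m\to\infty$, $$\mathrm{forb}(m,\{Q_3(t),F_9\})=\Theta(m).$$
   Context: A matrix is simple if it is a $(0,1)$-matrix with no repeated columns. $F\prec A$ means that some submatrix of $A$ is a row and column permutation of $F$. For a family $\mathcal F$ of $(0,1)$-matrices, $\mathrm{forb}(m,\mathcal F)$ is the maximum number of columns of an $m$-rowed simple matrix $A$ with $F\nprec A$ for all $F\in\mathcal F$. For $t\ge 2$, $Q_3(t)$ is the $2\times(2t+2)$ matrix whose columns are: $\begin{bmatrix}0\\0\end{bmatrix}$ once, $\begin{bmatrix}1\\0\end{bmatrix}$ exactly $t$ times, $\begin{bmatrix}0\\1\end{bmatrix}$ exactly $t$ times, and $\begin{bmatrix}1\\1\end{bmatrix}$ once. Also $$F_9=\begin{bmatrix}1&0&0\\0&1&0\\0&0&1\\0&0&1\end{bmatrix}.$$ *)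

theory Defs
  imports
    "Jordan_Normal_Form.DL_Submatrix"
    "HOL-Combinatorics.Permutations"
    "HOL-Library.Landau_Symbols"
begin

definition zero_one_mat :: "nat mat \<Rightarrow> bool" where
  "zero_one_mat A \<longleftrightarrow> elements_mat A \<subseteq> {0, 1}"

definition simple_mat :: "nat mat \<Rightarrow> bool" where
  "simple_mat A \<longleftrightarrow> zero_one_mat A \<and> distinct (cols A)"

definition row_col_perm :: "'a mat \<Rightarrow> 'a mat \<Rightarrow> bool" where
  "row_col_perm B F \<longleftrightarrow>
     dim_row B = dim_row F \<and> dim_col B = dim_col F \<and>
     (\<exists>p q. p permutes {0..<dim_row F} \<and> q permutes {0..<dim_col F} \<and>
        (\<forall>i<dim_row F. \<forall>j<dim_col F. B $$ (i, j) = F $$ (p i, q j)))"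

definition config_in :: "'a mat \<Rightarrow> 'a mat \<Rightarrow> bool"  (infix \<open>\<prec>\<close> 50) where
  "F \<prec> A \<longleftrightarrow> (\<exists>I J. row_col_perm (submatrix A I J) F)"

definition avoiding_col_counts :: "nat \<Rightarrow> nat mat set \<Rightarrow> nat set" where
  "avoiding_col_counts m \<F> =
     {n. \<exists>A \<in> carrier_mat m n. simple_mat A \<and> (\<forall>F\<in>\<F>. \<not> F \<prec> A)}"

definition forb :: "nat \<Rightarrow> nat mat set \<Rightarrow> nat" where
  "forb m \<F> = Max (avoiding_col_counts m \<F>)"

definition Q3 :: "nat \<Rightarrow> nat mat" where
  "Q3 t = mat_of_cols_list 2
     ([[0, 0]] @ replicate t [1, 0] @ replicate t [0, 1] @ [[1, 1]])"

definition F9 :: "nat mat" where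
  "F9 = mat_of_rows_list 3
     [[1, 0, 0],
      [0, 1, 0],
      [0, 0, 1],
      [0, 0, 1]]"

lemma Q3_carrier: "Q3 t \<in> carrier_mat 2 (2 * t + 2)"
  by (rule carrier_matI) (simp_all add: Q3_def mat_of_cols_list_def)

lemma F9_carrier: "F9 \<in> carrier_mat 4 3"
  by (rule carrier_matI) (simp_all add: F9_def mat_of_rows_list_def)

text \<open>
  The maximum defining \<^term>\<open>forb\<close> is taken over a finite set, which is nonempty as soon as
  every forbidden matrix has a column.
\<close>

lemma simple_mat_cols_le:
  assumes A: "A \<in> carrier_mat m n" and s: "simple_mat A"
  shows "n \<le> 2 ^ m"
proof -
  have d: "distinct (cols A)" and z: "elements_mat A \<subseteq> {0, 1}"
    using s by (auto simp: simple_mat_def zero_one_mat_def)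
  let ?L = "{xs. set xs \<subseteq> {0, 1::nat} \<and> length xs = m}"
  have inj: "inj_on list_of_vec (set (cols A))"
    by (rule inj_on_inverseI[of _ vec_of_list]) (rule vec_list)
  have sub: "list_of_vec ` set (cols A) \<subseteq> ?L"
  proof clarify
    fix v assume "v \<in> set (cols A)"
    then obtain j where j: "j < n" "v = col A j"
      using A by (auto simp: cols_def)
    have dim: "dim_vec v = m" using j A by auto
    have "v $ i \<in> {0, 1}" if "i < m" for i
      using elements_matI[OF A that j(1) refl] z j that A by auto
    then have "set (list_of_vec v) \<subseteq> {0, 1}"
      unfolding set_list_of_vec vec_set_def dim by (rule image_subsetI) simp
    with dim show "set (list_of_vec v) \<subseteq> {0, 1} \<and> length (list_of_vec v) = m"
      by simp
  qed
  have "n = card (set (cols A))" using A d by (simp add: distinct_card)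
  also have "\<dots> = card (list_of_vec ` set (cols A))"
    using card_image[OF inj] by simp
  also have "\<dots> \<le> card ?L"
    by (rule card_mono[OF finite_lists_length_eq sub]) simp
  also have "\<dots> = card {0, 1::nat} ^ m"
    by (rule card_lists_length_eq) simp
  also have "card {0, 1::nat} = 2" by simp
  finally show ?thesis .
qed

lemma finite_avoiding_col_counts: "finite (avoiding_col_counts m \<F>)"
  by (rule finite_subset[of _ "{..2 ^ m}"])
     (auto simp: avoiding_col_counts_def dest: simple_mat_cols_le)

lemma avoiding_col_counts_nonempty:
  assumes "\<forall>F\<in>\<F>. 0 < dim_col F"
  shows "avoiding_col_counts m \<F> \<noteq> {}"
proof -
  have "0 \<in> avoiding_col_counts m \<F>"
    unfolding avoiding_col_counts_def
  proof (clarify, intro bexI conjI ballI)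
    show "simple_mat (0\<^sub>m m 0)"
      by (auto simp: simple_mat_def zero_one_mat_def elements_mat_def cols_def)
    show "\<not> F \<prec> 0\<^sub>m m 0" if "F \<in> \<F>" for F
      using assms that by (auto simp: config_in_def row_col_perm_def dim_submatrix)
  qed auto
  then show ?thesis by auto
qed

end

theory Submission
  imports Defs
begin

text \<open>
  The identity matrix avoids both configurations because its columns have a single 1. For the
  upper bound, view the columns as a set family and delete the row $r$ with the most 1s; this
  costs only the number of columns $S$ that occur with both values in row $r$. If some row takes
  the value 0 and at least $t$ times the value 1 on these repeated columns, then together with
  $r$ it shows the columns 00, 11 and $t$ times 10, and by maximality of $r$ also $t$ times 01,
  that is $Q_3(t)$. So on the repeated columns every row is constantly 1 or has fewer than $t$
  1s. Among the rows of the latter kind, each element of a minimal hitting set of the nonempty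
  columns has a column meeting the set in that element only. Three such elements give $F_9$,
  with $r$ as its fourth row, so the hitting set has at most two elements and there are at most
  $2t$ repeated columns.
\<close>

section \<open>Configurations as injective choices of rows and columns\<close>

lemma bij_betw_pick:
  assumes "finite S"
  shows "bij_betw (pick S) {0..<card S} S"
proof -
  have inj: "inj_on (pick S) {0..<card S}"
    by (rule linorder_inj_onI) (force dest!: pick_mono_le)+
  have "pick S ` {0..<card S} \<subseteq> S"
    by (auto intro: pick_in_set_le)
  then have "pick S ` {0..<card S} = S"
    by (rule card_subset_eq[OF assms]) (simp add: card_image[OF inj])
  with inj show ?thesis by (simp add: bij_betw_def)
qed

text \<open>A submatrix lists its rows in increasing order, whereas \<open>f\<close> lists them in
  the order of the configuration. The permutation \<open>p\<close> translates between these
  orders.\<close>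

lemma pick_image_permutes:
  assumes inj: "inj_on f {0..<k}"
  obtains p where "p permutes {0..<k}" "\<And>i. i < k \<Longrightarrow> f (p i) = pick (f ` {0..<k}) i"
proof
  let ?I = "f ` {0..<k}"
  let ?p = "\<lambda>i. if i < k then inv_into {0..<k} f (pick ?I i) else i"
  have c: "card ?I = k" using card_image[OF inj] by simp
  have b: "bij_betw (pick ?I) {0..<k} ?I"
    using bij_betw_pick[of ?I] c by simp
  have "bij_betw (inv_into {0..<k} f \<circ> pick ?I) {0..<k} {0..<k}"
    by (rule bij_betw_trans[OF b]) (rule bij_betw_inv_into[OF inj_on_imp_bij_betw[OF inj]])
  then have "bij_betw ?p {0..<k} {0..<k}"
    by (rule iffD1[OF bij_betw_cong, rotated]) simp
  then show "?p permutes {0..<k}" by (rule bij_imp_permutes) simp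
  show "f (?p i) = pick ?I i" if "i < k" for i
  proof -
    have "pick ?I i \<in> ?I" using bij_betwE[OF b] that by simp
    then show ?thesis using that by (simp add: f_inv_into_f)
  qed
qed

text \<open>Sorting the chosen rows and columns permutes them, and \<open>row_col_perm\<close>
  absorbs exactly this. A configuration can thus be exhibited with rows and columns named in any
  order.\<close>

lemma config_inI:
  assumes A: "A \<in> carrier_mat m n" and B: "B \<in> carrier_mat k l"
    and f: "inj_on f {0..<k}" "f ` {0..<k} \<subseteq> {0..<m}"
    and g: "inj_on g {0..<l}" "g ` {0..<l} \<subseteq> {0..<n}"
    and eq: "\<And>a b. a < k \<Longrightarrow> b < l \<Longrightarrow> A $$ (f a, g b) = B $$ (a, b)"
  shows "B \<prec> A"
proof -
  let ?I = "f ` {0..<k}" and ?J = "g ` {0..<l}"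
  obtain p where p: "p permutes {0..<k}" "\<And>i. i < k \<Longrightarrow> f (p i) = pick ?I i"
    using pick_image_permutes[OF f(1)] by blast
  obtain q where q: "q permutes {0..<l}" "\<And>i. i < l \<Longrightarrow> g (q i) = pick ?J i"
    using pick_image_permutes[OF g(1)] by blast
  have I: "{i. i < dim_row A \<and> i \<in> ?I} = ?I" and J: "{i. i < dim_col A \<and> i \<in> ?J} = ?J"
    using f g A by auto
  have c: "card ?I = k" "card ?J = l"
    using card_image[OF f(1)] card_image[OF g(1)] by simp_all
  have "submatrix A ?I ?J $$ (i, j) = B $$ (p i, q j)" if "i < k" "j < l" for i j
  proof -
    have "p i < k" "q j < l"
      using permutes_in_image[OF p(1), of i] permutes_in_image[OF q(1), of j] that by simp_all
    then show ?thesis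
      using eq[of "p i" "q j"] p(2)[of i] q(2)[of j] that
      by (simp add: submatrix_index I J c)
  qed
  then have "row_col_perm (submatrix A ?I ?J) B"
    using p(1) q(1) B unfolding row_col_perm_def dim_submatrix I J c by auto
  then show ?thesis unfolding config_in_def by blast
qed

text \<open>The converse of \<open>config_inI\<close>, needed to show that the identity matrix
  avoids a configuration.\<close>

lemma config_inE:
  assumes "B \<prec> A"
  obtains f g where "inj_on f {0..<dim_row B}" "f ` {0..<dim_row B} \<subseteq> {0..<dim_row A}"
    "inj_on g {0..<dim_col B}" "g ` {0..<dim_col B} \<subseteq> {0..<dim_col A}"
    "\<And>a b. a < dim_row B \<Longrightarrow> b < dim_col B \<Longrightarrow> A $$ (f a, g b) = B $$ (a, b)"
proof -
  obtain I J where "row_col_perm (submatrix A I J) B"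
    using assms unfolding config_in_def by blast
  then obtain p q where d: "dim_row (submatrix A I J) = dim_row B"
      "dim_col (submatrix A I J) = dim_col B"
    and p: "p permutes {0..<dim_row B}" and q: "q permutes {0..<dim_col B}"
    and eq: "\<And>i j. i < dim_row B \<Longrightarrow> j < dim_col B \<Longrightarrow> submatrix A I J $$ (i, j) = B $$ (p i, q j)"
    unfolding row_col_perm_def by blast
  \<comment> \<open>\<open>submatrix\<close> ignores indices out of range, so \<open>I\<close> and
    \<open>J\<close> may even be infinite. Their restrictions are finite, and \<open>pick\<close>
    enumerates them completely.\<close>
  define I' where "I' = {i. i < dim_row A \<and> i \<in> I}"
  define J' where "J' = {j. j < dim_col A \<and> j \<in> J}"
  have c: "card I' = dim_row B" "card J' = dim_col B"
    using d unfolding dim_submatrix I'_def J'_def by auto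
  have bI: "bij_betw (pick I') {0..<dim_row B} I'" and bJ: "bij_betw (pick J') {0..<dim_col B} J'"
    using bij_betw_pick[of I'] bij_betw_pick[of J'] c unfolding I'_def J'_def by simp_all
  \<comment> \<open>Row \<open>a\<close> of \<open>B\<close> stands at position \<open>i\<close> of
    the submatrix with \<open>p i = a\<close>, hence the inverse of \<open>p\<close>.\<close>
  have bf: "bij_betw (pick I' \<circ> inv_into UNIV p) {0..<dim_row B} I'"
    by (rule bij_betw_trans[OF permutes_imp_bij[OF permutes_inv[OF p]] bI])
  have bg: "bij_betw (pick J' \<circ> inv_into UNIV q) {0..<dim_col B} J'"
    by (rule bij_betw_trans[OF permutes_imp_bij[OF permutes_inv[OF q]] bJ])
  show ?thesis
  proof (rule that)
    show "inj_on (pick I' \<circ> inv_into UNIV p) {0..<dim_row B}" "inj_on (pick J' \<circ> inv_into UNIV q) {0..<dim_col B}"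
      using bf bg by (auto dest: bij_betw_imp_inj_on)
    show "(pick I' \<circ> inv_into UNIV p) ` {0..<dim_row B} \<subseteq> {0..<dim_row A}"
      unfolding bij_betw_imp_surj_on[OF bf] by (auto simp: I'_def)
    show "(pick J' \<circ> inv_into UNIV q) ` {0..<dim_col B} \<subseteq> {0..<dim_col A}"
      unfolding bij_betw_imp_surj_on[OF bg] by (auto simp: J'_def)
    fix a b assume ab: "a < dim_row B" "b < dim_col B"
    have i: "inv_into UNIV p a < dim_row B" "inv_into UNIV q b < dim_col B"
      using ab permutes_in_image[OF permutes_inv[OF p], of a]
        permutes_in_image[OF permutes_inv[OF q], of b] by simp_all
    then have "submatrix A I J $$ (inv_into UNIV p a, inv_into UNIV q b) = A $$ (pick I (inv_into UNIV p a), pick J (inv_into UNIV q b))"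
      using c by (simp add: submatrix_index I'_def J'_def)
    also have "pick I (inv_into UNIV p a) = pick I' (inv_into UNIV p a)"
      using pick_reduce_set[of "inv_into UNIV p a" "dim_row A" I] i c by (simp add: I'_def)
    also have "pick J (inv_into UNIV q b) = pick J' (inv_into UNIV q b)"
      using pick_reduce_set[of "inv_into UNIV q b" "dim_col A" J] i c by (simp add: J'_def)
    finally show "A $$ ((pick I' \<circ> inv_into UNIV p) a, (pick J' \<circ> inv_into UNIV q) b) = B $$ (a, b)"
      using eq[OF i] permutes_inverses(1)[OF p] permutes_inverses(1)[OF q] by simp
  qed
qed

section \<open>Exhibiting the two configurations in a matrix\<close>

lemma Q3_index:
  assumes "b < 2 * t + 2"
  shows "Q3 t $$ (0, b) = ([0] @ replicate t 1 @ replicate t 0 @ [1]) ! b"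
    and "Q3 t $$ (1, b) = ([0] @ replicate t 0 @ replicate t 1 @ [1]) ! b"
proof -
  let ?L = "[[0, 0]] @ replicate t [1, 0] @ replicate t [0, 1] @ [[1, 1::nat]]"
  have len: "b < length ?L" using assms by simp
  have "Q3 t $$ (i, b) = map (\<lambda>c. c ! i) ?L ! b" if "i < 2" for i
    unfolding nth_map[OF len] using len that unfolding Q3_def mat_of_cols_list_def by simp
  from this[of 0] this[of 1]
  show "Q3 t $$ (0, b) = ([0] @ replicate t 1 @ replicate t 0 @ [1]) ! b"
    "Q3 t $$ (1, b) = ([0] @ replicate t 0 @ replicate t 1 @ [1]) ! b"
    by simp_all
qed

text \<open>Lower bounds on the two counts suffice, since exactly \<open>t\<close> columns of each
  kind can be selected from them.\<close>

lemma Q3_configI: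
  assumes A: "A \<in> carrier_mat m n" and ij: "i < m" "j < m" "i \<noteq> j"
    and c0: "c0 < n" "A $$ (i, c0) = 0" "A $$ (j, c0) = 0"
    and c1: "c1 < n" "A $$ (i, c1) = 1" "A $$ (j, c1) = 1"
    and X: "t \<le> card {c. c < n \<and> A $$ (i, c) = 1 \<and> A $$ (j, c) = 0}"
    and Y: "t \<le> card {c. c < n \<and> A $$ (i, c) = 0 \<and> A $$ (j, c) = 1}"
  shows "Q3 t \<prec> A"
proof -
  obtain X where X: "X \<subseteq> {c. c < n \<and> A $$ (i, c) = 1 \<and> A $$ (j, c) = 0}" "card X = t" "finite X"
    using obtain_subset_with_card_n[OF X] .
  obtain xs where xs: "set xs = X" "distinct xs" "length xs = t"
    using finite_distinct_list[OF X(3)] X(2) distinct_card by metis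
  obtain Y where Y: "Y \<subseteq> {c. c < n \<and> A $$ (i, c) = 0 \<and> A $$ (j, c) = 1}" "card Y = t" "finite Y"
    using obtain_subset_with_card_n[OF Y] .
  obtain ys where ys: "set ys = Y" "distinct ys" "length ys = t"
    using finite_distinct_list[OF Y(3)] Y(2) distinct_card by metis
  \<comment> \<open>The selected columns, in the order in which \<open>Q3 t\<close> lists its
    own.\<close>
  define zs where "zs = [c0] @ xs @ ys @ [c1]"
  have len: "length zs = 2 * t + 2" using xs ys by (simp add: zs_def)
  have "X \<inter> Y = {}" using X(1) Y(1) by fastforce
  then have dist: "distinct zs" using X(1) Y(1) xs ys c0 c1 by (auto simp: zs_def)
  have sub: "set zs \<subseteq> {0..<n}" using X(1) Y(1) xs ys c0 c1 by (auto simp: zs_def)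
  have "map (\<lambda>c. A $$ (i, c)) zs = [0] @ replicate t 1 @ replicate t 0 @ [1]"
    using X(1) Y(1) xs ys c0 c1 by (auto simp: zs_def intro!: replicate_eqI)
  then have r0: "A $$ (i, zs ! b) = Q3 t $$ (0, b)" if "b < 2 * t + 2" for b
    unfolding Q3_index(1)[OF that] using that len by (metis nth_map)
  have "map (\<lambda>c. A $$ (j, c)) zs = [0] @ replicate t 0 @ replicate t 1 @ [1]"
    using X(1) Y(1) xs ys c0 c1 by (auto simp: zs_def intro!: replicate_eqI)
  then have r1: "A $$ (j, zs ! b) = Q3 t $$ (1, b)" if "b < 2 * t + 2" for b
    unfolding Q3_index(2)[OF that] using that len by (metis nth_map)
  show ?thesis
  proof (rule config_inI[OF A Q3_carrier])
    let ?f = "\<lambda>a::nat. if a = 0 then i else j"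
    show "inj_on ?f {0..<2}" using ij by (auto simp: inj_on_def)
    show "?f ` {0..<2} \<subseteq> {0..<m}" using ij by auto
    show "inj_on ((!) zs) {0..<2 * t + 2}"
      using dist len by (auto simp: inj_on_def nth_eq_iff_index_eq)
    show "(!) zs ` {0..<2 * t + 2} \<subseteq> {0..<n}"
      unfolding image_subset_iff using sub len by (metis atLeastLessThan_iff nth_mem subsetD)
    show "A $$ (?f a, zs ! b) = Q3 t $$ (a, b)" if "a < 2" "b < 2 * t + 2" for a b
    proof -
      consider "a = 0" | "a = 1" using \<open>a < 2\<close> by linarith
      then show ?thesis using r0[OF that(2)] r1[OF that(2)] by cases simp_all
    qed
  qed
qed

text \<open>Only the last two rows of \<open>F9\<close> agree, so only \<open>r3\<close> and
  \<open>r4\<close> must be assumed distinct. The entries themselves separate all other rows and all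
  columns.\<close>

lemma F9_configI:
  assumes A: "A \<in> carrier_mat m n"
    and rows: "r1 < m" "r2 < m" "r3 < m" "r4 < m" "r3 \<noteq> r4"
    and cs: "c1 < n" "c2 < n" "c3 < n"
    and e1: "A $$ (r1, c1) = 1" "A $$ (r2, c1) = 0" "A $$ (r3, c1) = 0" "A $$ (r4, c1) = 0"
    and e2: "A $$ (r1, c2) = 0" "A $$ (r2, c2) = 1" "A $$ (r3, c2) = 0" "A $$ (r4, c2) = 0"
    and e3: "A $$ (r1, c3) = 0" "A $$ (r2, c3) = 0" "A $$ (r3, c3) = 1" "A $$ (r4, c3) = 1"
  shows "F9 \<prec> A"
proof (rule config_inI[OF A F9_carrier])
  let ?f = "\<lambda>a. [r1, r2, r3, r4] ! a" and ?g = "\<lambda>b. [c1, c2, c3] ! b"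
  have "distinct [r1, r2, r3, r4]" "distinct [c1, c2, c3]"
    using rows e1 e2 e3 by auto
  then show "inj_on ?f {0..<4}" "inj_on ?g {0..<3}"
    by (auto simp: inj_on_def nth_eq_iff_index_eq simp del: distinct.simps)
  have 4: "{0..<4::nat} = {0, 1, 2, 3}" and 3: "{0..<3::nat} = {0, 1, 2}" by auto
  show "?f ` {0..<4} \<subseteq> {0..<m}" "?g ` {0..<3} \<subseteq> {0..<n}"
    unfolding 4 3 using rows cs by (auto simp: numeral_eq_Suc)
  show "A $$ (?f a, ?g b) = F9 $$ (a, b)" if "a < 4" "b < 3" for a b
  proof -
    have "a \<in> {0, 1, 2, 3}" "b \<in> {0, 1, 2}" using that by auto
    then show ?thesis using e1 e2 e3
      by (auto simp: F9_def mat_of_rows_list_def numeral_eq_Suc)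
  qed
qed

section \<open>Avoidance for set families, and its inheritance by traces\<close>

text \<open>
  Rows range over the whole type: a row outside the ground set contains no 1 and so occurs in
  neither configuration.
\<close>

definition avoids_Q3 :: "nat \<Rightarrow> 'a set set \<Rightarrow> bool" where
  "avoids_Q3 t F \<longleftrightarrow> (\<forall>i j. i \<noteq> j \<longrightarrow> (\<exists>S\<in>F. i \<notin> S \<and> j \<notin> S) \<longrightarrow> (\<exists>S\<in>F. i \<in> S \<and> j \<in> S) \<longrightarrow>
     card {S \<in> F. i \<in> S \<and> j \<notin> S} < t \<or> card {S \<in> F. i \<notin> S \<and> j \<in> S} < t)"

definition avoids_F9 :: "'a set set \<Rightarrow> bool" where
  "avoids_F9 F \<longleftrightarrow> (\<forall>A\<in>F. \<forall>B\<in>F. \<forall>C\<in>F. \<forall>x y z w. x \<in> A - B - C \<longrightarrow> y \<in> B - A - C \<longrightarrow>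
     z \<in> C - A - B \<longrightarrow> w \<in> C - A - B \<longrightarrow> z = w)"

text \<open>A member of the trace contains \<open>i\<close> and \<open>j\<close>, so both differ
  from \<open>r\<close>. Deleting \<open>r\<close> can merge members but never creates new ones, so
  the two counts cannot grow.\<close>

lemma avoids_Q3_trace:
  assumes fin: "finite F" and F: "avoids_Q3 t F"
  shows "avoids_Q3 t ((\<lambda>S. S - {r}) ` F)"
  unfolding avoids_Q3_def
proof (intro allI impI)
  let ?G = "(\<lambda>S. S - {r}) ` F"
  fix i j assume ij: "i \<noteq> j"
    and 0: "\<exists>S\<in>?G. i \<notin> S \<and> j \<notin> S" and 1: "\<exists>S\<in>?G. i \<in> S \<and> j \<in> S"
  have r: "i \<noteq> r" "j \<noteq> r" using 1 by auto
  have "{S \<in> ?G. i \<in> S \<and> j \<notin> S} \<subseteq> (\<lambda>S. S - {r}) ` {S \<in> F. i \<in> S \<and> j \<notin> S}"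
    "{S \<in> ?G. i \<notin> S \<and> j \<in> S} \<subseteq> (\<lambda>S. S - {r}) ` {S \<in> F. i \<notin> S \<and> j \<in> S}"
    using r by auto
  then have "card {S \<in> ?G. i \<in> S \<and> j \<notin> S} \<le> card {S \<in> F. i \<in> S \<and> j \<notin> S}"
    "card {S \<in> ?G. i \<notin> S \<and> j \<in> S} \<le> card {S \<in> F. i \<notin> S \<and> j \<in> S}"
    using fin by (simp_all add: surj_card_le)
  moreover have "card {S \<in> F. i \<in> S \<and> j \<notin> S} < t \<or> card {S \<in> F. i \<notin> S \<and> j \<in> S} < t"
    using F[unfolded avoids_Q3_def, rule_format, OF ij] 0 1 r by auto
  ultimately show "card {S \<in> ?G. i \<in> S \<and> j \<notin> S} < t \<or> card {S \<in> ?G. i \<notin> S \<and> j \<in> S} < t"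
    by linarith
qed

lemma avoids_F9_trace:
  assumes "avoids_F9 F"
  shows "avoids_F9 ((\<lambda>S. S - {r}) ` F)"
  using assms unfolding avoids_F9_def by blast

section \<open>Counting the loss when a row is deleted\<close>

definition repeated :: "'a \<Rightarrow> 'a set set \<Rightarrow> 'a set set" where
  "repeated r F = {S \<in> F. r \<notin> S \<and> insert r S \<in> F}"

text \<open>Deleting \<open>r\<close> is injective on the members without \<open>r\<close> and on
  those with \<open>r\<close>. The images of these two halves overlap exactly in the repeated sets,
  which the trace therefore counts only once.\<close>

lemma card_trace_repeated:
  assumes fin: "finite F"
  shows "card F = card ((\<lambda>S. S - {r}) ` F) + card (repeated r F)"
proof -
  let ?d = "\<lambda>S. S - {r}"
  let ?F0 = "{S \<in> F. r \<notin> S}" and ?F1 = "{S \<in> F. r \<in> S}"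
  have i: "inj_on ?d ?F1" by (rule inj_on_inverseI[of _ "insert r"]) auto
  have "card F = card ?F0 + card ?F1"
    by (subst card_Un_disjoint[symmetric]) (use fin in \<open>auto intro: arg_cong[where f = card]\<close>)
  also have "card ?F1 = card (?d ` ?F1)" using card_image[OF i] by simp
  also have "card ?F0 + card (?d ` ?F1) = card (?F0 \<union> ?d ` ?F1) + card (?F0 \<inter> ?d ` ?F1)"
    by (rule card_Un_Int) (use fin in auto)
  also have "?F0 \<union> ?d ` ?F1 = ?d ` F"
  proof -
    have "?d ` F = ?d ` (?F0 \<union> ?F1)" by (rule arg_cong[where f = "(`) ?d"]) auto
    moreover have "?d ` ?F0 = ?F0" by simp
    ultimately show ?thesis by (simp only: image_Un)
  qed
  also have "?F0 \<inter> ?d ` ?F1 = repeated r F"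
  proof (intro equalityI subsetI)
    fix S assume "S \<in> repeated r F"
    then have "S \<in> ?F0" "insert r S \<in> ?F1" "S = insert r S - {r}"
      by (auto simp: repeated_def)
    then show "S \<in> ?F0 \<inter> ?d ` ?F1" by blast
  qed (auto simp: repeated_def insert_absorb)
  finally show ?thesis .
qed

section \<open>Bounding the number of repeated columns\<close>

text \<open>By minimality, removing \<open>x\<close> from \<open>X\<close> leaves some member of
  \<open>G\<close> unhit, and that member meets \<open>X\<close> in \<open>x\<close> alone.\<close>

lemma ex_minimal_hitting_set:
  assumes fin: "finite (\<Union>G)" and ne: "{} \<notin> G"
  obtains X where "X \<subseteq> \<Union>G" "\<And>S. S \<in> G \<Longrightarrow> S \<inter> X \<noteq> {}"
    "\<And>x. x \<in> X \<Longrightarrow> \<exists>S\<in>G. S \<inter> X = {x}"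
proof -
  let ?H = "{X. X \<subseteq> \<Union>G \<and> (\<forall>S\<in>G. S \<inter> X \<noteq> {})}"
  have "finite ?H" by (rule finite_subset[of _ "Pow (\<Union>G)"]) (use fin in auto)
  moreover have "\<Union>G \<in> ?H" using ne by (auto simp: inf.absorb1 Union_upper)
  ultimately obtain X where X: "X \<in> ?H" and m: "\<And>Y. Y \<in> ?H \<Longrightarrow> Y \<subseteq> X \<Longrightarrow> X = Y"
    using finite_has_minimal[of ?H] by (metis (no_types, lifting) empty_iff)
  show ?thesis
  proof (rule that[of X])
    show "X \<subseteq> \<Union>G" "\<And>S. S \<in> G \<Longrightarrow> S \<inter> X \<noteq> {}" using X by auto
    fix x assume x: "x \<in> X"
    then have "X - {x} \<notin> ?H" using m[of "X - {x}"] by auto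
    then obtain S where "S \<in> G" "S \<inter> (X - {x}) = {}" using X by auto
    then show "\<exists>S\<in>G. S \<inter> X = {x}" using X by blast
  qed
qed

lemma card_repeated_le:
  assumes finF: "finite F" and finU: "finite (\<Union>F)" and t: "t \<ge> 1"
    and Q: "avoids_Q3 t F" and N: "avoids_F9 F"
    and max: "\<And>i. card {S \<in> F. i \<in> S} \<le> card {S \<in> F. r \<in> S}"
  shows "card (repeated r F) \<le> 2 * t"
proof -
  define C where "C = repeated r F"
  \<comment> \<open>The rows that are constantly 1 on the repeated columns. Every member of
    \<open>C\<close> contains \<open>U\<close>, so removing \<open>U\<close> keeps the members
    distinct.\<close>
  define U where "U = \<Inter>C"
  define G where "G = (\<lambda>S. S - U) ` C - {{}}"
  have CF: "S \<in> F" "r \<notin> S" "insert r S \<in> F" if "S \<in> C" for S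
    using that by (auto simp: C_def repeated_def)
  have finC: "finite C" using finF CF by (auto intro: finite_subset)
  have finG: "finite G" using finC by (simp add: G_def)
  have few_C: "card {S \<in> C. i \<in> S} < t" if i: "i \<notin> U" "i \<noteq> r" for i
  proof (rule ccontr)
    assume "\<not> ?thesis"
    then have many: "t \<le> card {S \<in> C. i \<in> S}" by simp
    also have "\<dots> \<le> card {S \<in> F. i \<in> S \<and> r \<notin> S}"
      by (rule card_mono) (use finF CF in auto)
    finally have i_not_r: "t \<le> card {S \<in> F. i \<in> S \<and> r \<notin> S}" .
    \<comment> \<open>\<open>T\<close> will supply the column 00 in rows \<open>i\<close> and
      \<open>r\<close>; \<open>insert r S\<close>, for the set \<open>S\<close> found next, will
      supply 11.\<close>
    obtain T where T: "T \<in> C" "i \<notin> T" using i by (auto simp: U_def)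
    have "{S \<in> C. i \<in> S} \<noteq> {}" using many t by (metis card.empty not_one_le_zero le_trans)
    then obtain S where S: "S \<in> C" "i \<in> S" by auto
    \<comment> \<open>The members containing both \<open>i\<close> and \<open>r\<close> contribute
      equally to both degrees. By maximality of \<open>r\<close>, those with only \<open>r\<close>
      are thus at least as many as those with only \<open>i\<close>.\<close>
    have split: "card {S \<in> F. a \<in> S} = card {S \<in> F. a \<in> S \<and> b \<in> S} + card {S \<in> F. a \<in> S \<and> b \<notin> S}"
      for a b
      by (subst card_Un_disjoint[symmetric]) (use finF in \<open>auto intro: arg_cong[where f = card]\<close>)
    have "{S \<in> F. i \<in> S \<and> r \<in> S} = {S \<in> F. r \<in> S \<and> i \<in> S}"
      "{S \<in> F. i \<notin> S \<and> r \<in> S} = {S \<in> F. r \<in> S \<and> i \<notin> S}" by auto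
    then have "t \<le> card {S \<in> F. i \<notin> S \<and> r \<in> S}"
      using i_not_r max[of i] split[of i r] split[of r i] by simp
    moreover have "\<exists>S\<in>F. i \<notin> S \<and> r \<notin> S" using T CF[OF T(1)] by auto
    moreover have "\<exists>S\<in>F. i \<in> S \<and> r \<in> S" using S CF(3)[OF S(1)] by auto
    ultimately show False
      using Q i_not_r i(2) unfolding avoids_Q3_def by (meson not_less)
  qed
  have few: "card {S \<in> G. x \<in> S} \<le> t - 1" if x: "x \<in> \<Union>G" for x
  proof -
    have xU: "x \<notin> U" "x \<noteq> r" using x CF(2) by (auto simp: G_def)
    have "{S \<in> G. x \<in> S} \<subseteq> (\<lambda>S. S - U) ` {S \<in> C. x \<in> S}" by (auto simp: G_def)
    then have "card {S \<in> G. x \<in> S} \<le> card {S \<in> C. x \<in> S}"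
      using finC by (auto intro: surj_card_le)
    with few_C[OF xU] show ?thesis by linarith
  qed
  have "finite (\<Union>G)"
    by (rule finite_subset[OF _ finU]) (use CF in \<open>auto simp: G_def\<close>)
  moreover have "{} \<notin> G" by (simp add: G_def)
  ultimately obtain X where X: "X \<subseteq> \<Union>G" "\<And>S. S \<in> G \<Longrightarrow> S \<inter> X \<noteq> {}"
      and priv: "\<And>x. x \<in> X \<Longrightarrow> \<exists>S\<in>G. S \<inter> X = {x}"
    using ex_minimal_hitting_set[of G] by metis
  have finX: "finite X" using X(1) \<open>finite (\<Union>G)\<close> by (rule finite_subset)
  have "card X \<le> 2"
  proof (rule ccontr)
    assume "\<not> ?thesis"
    then have "3 \<le> card X" by simp
    then obtain Y where "Y \<subseteq> X" "card Y = 3" by (rule obtain_subset_with_card_n)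
    then obtain x y z where xyz: "x \<in> X" "y \<in> X" "z \<in> X" "x \<noteq> y" "y \<noteq> z" "x \<noteq> z"
      by (auto simp: card_3_iff)
    have notU: "w \<notin> U" "w \<noteq> r" if "w \<in> X" for w
      using that X(1) CF(2) by (auto simp: G_def)
    \<comment> \<open>Since \<open>X\<close> is disjoint from \<open>U\<close>, a private member of
      \<open>G\<close> pulls back to a member of \<open>C\<close> that meets \<open>X\<close> in the
      same single element.\<close>
    have P: "\<exists>S\<in>C. w \<in> S \<and> (\<forall>v\<in>X. v \<in> S \<longrightarrow> v = w)" if w: "w \<in> X" for w
    proof -
      obtain S where "S \<in> C" "(S - U) \<inter> X = {w}"
        using priv[OF w] by (auto simp: G_def)
      then show ?thesis using notU by (intro bexI[of _ S]) auto
    qed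
    obtain A where A: "A \<in> C" "x \<in> A" "y \<notin> A" "z \<notin> A" using P[of x] xyz by metis
    obtain B where B: "B \<in> C" "y \<in> B" "x \<notin> B" "z \<notin> B" using P[of y] xyz by metis
    obtain D where D: "D \<in> C" "z \<in> D" "x \<notin> D" "y \<notin> D" using P[of z] xyz by metis
    \<comment> \<open>Using the copy of \<open>D\<close> that contains \<open>r\<close> makes
      \<open>r\<close> the second row shared by the third column, while \<open>A\<close> and
      \<open>B\<close> miss it.\<close>
    have "x \<in> A - B - insert r D" "y \<in> B - A - insert r D"
      "z \<in> insert r D - A - B" "r \<in> insert r D - A - B"
      using A B D CF(2) notU xyz by auto
    then have "z = r"
      using N CF(1)[OF A(1)] CF(1)[OF B(1)] CF(3)[OF D(1)] unfolding avoids_F9_def by meson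
    with notU xyz show False by blast
  qed
  \<comment> \<open>Every member of \<open>G\<close> meets \<open>X\<close>, so the members through
    the points of \<open>X\<close> cover \<open>G\<close>, fewer than \<open>t\<close> at each
    point.\<close>
  have "card G \<le> card (\<Union>x\<in>X. {S \<in> G. x \<in> S})"
    by (rule card_mono) (use finX finG X(2) in auto)
  also have "\<dots> \<le> (\<Sum>x\<in>X. card {S \<in> G. x \<in> S})" by (rule card_UN_le[OF finX])
  also have "\<dots> \<le> card X * (t - 1)"
    by (rule order_trans[OF sum_bounded_above[where K = "t - 1"]]) (use few X(1) in blast, simp)
  also have "\<dots> \<le> 2 * (t - 1)" using \<open>card X \<le> 2\<close> by simp
  finally have G: "card G \<le> 2 * (t - 1)" .
  have "inj_on (\<lambda>S. S - U) C"
    by (rule inj_on_inverseI[of _ "\<lambda>S. S \<union> U"]) (auto simp: U_def)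
  then have "card C = card ((\<lambda>S. S - U) ` C)" by (simp add: card_image)
  \<comment> \<open>The empty set was excluded from \<open>G\<close>, where nothing could hit it.
    Restoring it gives at most \<open>2 * (t - 1) + 1\<close> repeated columns.\<close>
  also have "\<dots> \<le> card (insert {} G)"
    by (rule card_mono) (use finG in \<open>auto simp: G_def\<close>)
  also have "\<dots> \<le> Suc (card G)" by (rule card_insert_le_m1) auto
  finally show ?thesis using G t unfolding C_def by linarith
qed

section \<open>The linear upper bound, for families and then for matrices\<close>

text \<open>Deleting a row of maximum degree costs at most \<open>2 * t\<close> members, and over
  the empty ground set at most one member remains.\<close>

lemma card_avoiding_family_le:
  assumes "finite R" "F \<subseteq> Pow R" "t \<ge> 1" "avoids_Q3 t F" "avoids_F9 F"
  shows "card F \<le> 2 * t * card R + 1"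
  using assms
proof (induction "card R" arbitrary: R F)
  case 0
  then have "F \<subseteq> {{}}" by auto
  then have "card F \<le> card {{} :: 'a set}" by (intro card_mono) auto
  then show ?case by simp
next
  case (Suc n)
  have finF: "finite F" using Suc.prems by (auto intro: finite_subset)
  have finU: "finite (\<Union>F)" using Suc.prems by (auto intro: finite_subset)
  let ?d = "\<lambda>i. card {S \<in> F. i \<in> S}"
  have "R \<noteq> {}" using Suc.hyps(2) by auto
  then obtain r where r: "r \<in> R" "?d r = Max (?d ` R)"
    using Max_in[of "?d ` R"] Suc.prems(1) by (metis (no_types, lifting) finite_imageI image_iff image_is_empty)
  \<comment> \<open>Maximality is required over the whole type; points outside \<open>R\<close> have
    degree 0.\<close>
  have max: "?d i \<le> ?d r" for i
  proof (cases "i \<in> R")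
    case True
    then show ?thesis unfolding r(2) using Suc.prems(1) by (intro Max_ge) auto
  next
    case False
    then have "{S \<in> F. i \<in> S} = {}" using Suc.prems(2) by auto
    then show ?thesis by (simp only: card.empty)
  qed
  let ?F = "(\<lambda>S. S - {r}) ` F"
  have c: "n = card (R - {r})" using Suc.hyps(2) r(1) Suc.prems(1) by simp
  have "card ?F \<le> 2 * t * n + 1"
    unfolding c by (rule Suc.hyps(1)[OF c])
      (use Suc.prems finF in \<open>auto intro: avoids_Q3_trace avoids_F9_trace\<close>)
  moreover have "card (repeated r F) \<le> 2 * t"
    using card_repeated_le[OF finF finU Suc.prems(3-5) max] .
  moreover have "card F = card ?F + card (repeated r F)" by (rule card_trace_repeated[OF finF])
  ultimately show ?case by (simp flip: Suc.hyps(2))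
qed

text \<open>Columns are replaced by their supports. Simplicity makes this injective, so the family
  has as many members as the matrix has columns.\<close>

lemma avoiding_mat_cols_le:
  assumes t: "t \<ge> 1" and A: "A \<in> carrier_mat m n" and s: "simple_mat A"
    and Q: "\<not> Q3 t \<prec> A" and N: "\<not> F9 \<prec> A"
  shows "n \<le> 2 * t * m + 1"
proof -
  define supp where "supp c = {i. i < m \<and> A $$ (i, c) = 1}" for c
  define F where "F = supp ` {0..<n}"
  have d: "distinct (cols A)" and z: "elements_mat A \<subseteq> {0, 1}"
    using s by (auto simp: simple_mat_def zero_one_mat_def)
  have 01: "A $$ (i, c) = 0 \<or> A $$ (i, c) = 1" if "i < m" "c < n" for i c
    using elements_matI[OF A that refl] z by auto
  have inj: "inj_on supp {0..<n}"
  proof (rule inj_onI)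
    fix c c' assume c: "c \<in> {0..<n}" "c' \<in> {0..<n}" and eq: "supp c = supp c'"
    have "A $$ (i, c) = A $$ (i, c')" if i: "i < m" for i
    proof -
      have "i \<in> supp c \<longleftrightarrow> i \<in> supp c'" using eq by simp
      then have "A $$ (i, c) = 1 \<longleftrightarrow> A $$ (i, c') = 1" using i by (simp add: supp_def)
      moreover have "c < n" "c' < n" using c by simp_all
      ultimately show ?thesis using 01[OF i] by metis
    qed
    then have "col A c = col A c'" using A c by (intro eq_vecI) auto
    then show "c = c'" using d c A nth_eq_iff_index_eq[OF d, of c c'] by (simp add: cols_nth)
  qed
  have mem: "i \<in> supp c \<longleftrightarrow> A $$ (i, c) = 1" "i \<notin> supp c \<longleftrightarrow> A $$ (i, c) = 0"
    if "i < m" "c < n" for i c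
    using 01[OF that] that by (auto simp: supp_def)
  have "avoids_Q3 t F"
    unfolding avoids_Q3_def
  proof (intro allI impI)
    fix i j assume ij: "i \<noteq> j" and "\<exists>S\<in>F. i \<notin> S \<and> j \<notin> S" "\<exists>S\<in>F. i \<in> S \<and> j \<in> S"
    then obtain c0 c1 where c: "c0 < n" "i \<notin> supp c0" "j \<notin> supp c0"
        "c1 < n" "i \<in> supp c1" "j \<in> supp c1"
      by (auto simp: F_def)
    then have m: "i < m" "j < m" by (auto simp: supp_def)
    \<comment> \<open>Injectivity of \<open>supp\<close> turns counts of members into counts of
      columns, as \<open>Q3_configI\<close> expects them.\<close>
    have count: "card {S \<in> F. P S} = card {c. c < n \<and> P (supp c)}" for P
    proof -
      have "{S \<in> F. P S} = supp ` {c. c < n \<and> P (supp c)}" by (auto simp: F_def)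
      moreover have "inj_on supp {c. c < n \<and> P (supp c)}" by (rule inj_on_subset[OF inj]) auto
      ultimately show ?thesis by (simp add: card_image)
    qed
    have "card {S \<in> F. i \<in> S \<and> j \<notin> S} = card {c. c < n \<and> A $$ (i, c) = 1 \<and> A $$ (j, c) = 0}"
      "card {S \<in> F. i \<notin> S \<and> j \<in> S} = card {c. c < n \<and> A $$ (i, c) = 0 \<and> A $$ (j, c) = 1}"
      unfolding count using mem m by (auto intro!: arg_cong[where f = card])
    then show "card {S \<in> F. i \<in> S \<and> j \<notin> S} < t \<or> card {S \<in> F. i \<notin> S \<and> j \<in> S} < t"
      using Q Q3_configI[OF A m ij, of c0 c1 t] c mem m by fastforce
  qed
  moreover have "avoids_F9 F"
    unfolding avoids_F9_def
  proof (intro ballI allI impI)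
    fix S T V x y z w
    assume "S \<in> F" "T \<in> F" "V \<in> F" and
      xyzw: "x \<in> S - T - V" "y \<in> T - S - V" "z \<in> V - S - T" "w \<in> V - S - T"
    then obtain a b c where abc: "a < n" "b < n" "c < n" "S = supp a" "T = supp b" "V = supp c"
      by (auto simp: F_def)
    have m: "x < m" "y < m" "z < m" "w < m" using xyzw abc by (auto simp: supp_def)
    show "z = w"
      using N F9_configI[OF A m _ abc(1-3)] xyzw abc mem m by fastforce
  qed
  ultimately have "card F \<le> 2 * t * card {0..<m} + 1"
    by (intro card_avoiding_family_le) (use t in \<open>auto simp: F_def supp_def\<close>)
  moreover have "card F = n" unfolding F_def using card_image[OF inj] by simp
  ultimately show ?thesis by simp
qed

section \<open>The lower bound from the identity matrix\<close>

text \<open>A column of the identity matrix has its only 1 on the diagonal, so two 1s in one column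
  of \<open>B\<close> would have to come from the same row.\<close>

lemma config_in_one_mat_column:
  assumes "B \<prec> (1\<^sub>m m :: nat mat)" "a < dim_row B" "b < dim_row B" "c < dim_col B"
    "B $$ (a, c) = 1" "B $$ (b, c) = 1"
  shows "a = b"
proof -
  obtain f g where f: "inj_on f {0..<dim_row B}" "f ` {0..<dim_row B} \<subseteq> {0..<m}"
    and g: "g ` {0..<dim_col B} \<subseteq> {0..<m}"
    and eq: "\<And>a b. a < dim_row B \<Longrightarrow> b < dim_col B \<Longrightarrow> 1\<^sub>m m $$ (f a, g b) = B $$ (a, b)"
    using config_inE[OF assms(1)] by (metis index_one_mat(2,3))
  have "f x = g c" if "x < dim_row B" "B $$ (x, c) = 1" for x
  proof -
    have "f x < m" "g c < m" using f(2) g that(1) assms(4) by (simp_all add: image_subset_iff)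
    moreover have "1\<^sub>m m $$ (f x, g c) = (1 :: nat)" using eq[OF that(1) assms(4)] that(2) by simp
    ultimately show ?thesis by (metis index_one_mat(1) zero_neq_one)
  qed
  then have "f a = f b" using assms by simp
  then show ?thesis using f(1) assms(2,3) by (simp add: inj_on_eq_iff)
qed

text \<open>Both configurations have a column with two 1s, in each case the last one.\<close>

lemma one_mat_avoids: "\<not> Q3 t \<prec> 1\<^sub>m m" "\<not> F9 \<prec> 1\<^sub>m m"
proof -
  have "Q3 t $$ (0, 2 * t + 1) = 1" "Q3 t $$ (1, 2 * t + 1) = 1"
    using Q3_index[of "2 * t + 1" t] by (simp_all add: nth_append)
  then show "\<not> Q3 t \<prec> 1\<^sub>m m"
    using config_in_one_mat_column[of "Q3 t" m 0 1 "2 * t + 1"] Q3_carrier[of t] by auto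
  have "F9 $$ (2, 2) = 1" "F9 $$ (3, 2) = 1"
    by (simp_all add: F9_def mat_of_rows_list_def numeral_eq_Suc)
  then show "\<not> F9 \<prec> 1\<^sub>m m"
    using config_in_one_mat_column[of F9 m 2 3 2] F9_carrier by auto
qed

lemma simple_one_mat: "simple_mat (1\<^sub>m m)"
proof -
  have "elements_mat (1\<^sub>m m :: nat mat) \<subseteq> {0, 1}" by (auto simp: elements_mat_def)
  moreover have "distinct (cols (1\<^sub>m m :: nat mat))"
    by (auto simp: distinct_conv_nth cols_nth dest: arg_cong[where f = "\<lambda>v. v $ _"])
  ultimately show ?thesis by (simp add: simple_mat_def zero_one_mat_def)
qed

theorem theorem6p1:
  fixes t :: nat
  assumes "t \<ge> 2"
  shows "(\<lambda>m. real (forb m {Q3 t, F9})) \<in> \<Theta>(\<lambda>m. real m)"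
proof -
  have lower: "m \<le> forb m {Q3 t, F9}" for m
    unfolding forb_def
  proof (rule Max_ge[OF finite_avoiding_col_counts])
    show "m \<in> avoiding_col_counts m {Q3 t, F9}"
      unfolding avoiding_col_counts_def
      using one_mat_avoids simple_one_mat by (auto intro!: bexI[of _ "1\<^sub>m m"])
  qed
  have upper: "forb m {Q3 t, F9} \<le> 2 * t * m + 1" for m
    unfolding forb_def
  proof (rule Max.boundedI[OF finite_avoiding_col_counts])
    show "avoiding_col_counts m {Q3 t, F9} \<noteq> {}"
      by (rule avoiding_col_counts_nonempty) (use Q3_carrier[of t] F9_carrier in auto)
    show "n \<le> 2 * t * m + 1" if "n \<in> avoiding_col_counts m {Q3 t, F9}" for n
      using that avoiding_mat_cols_le[of t _ m n] assms by (auto simp: avoiding_col_counts_def)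
  qed
  show ?thesis
  proof (rule bigthetaI)
    show "(\<lambda>m. real (forb m {Q3 t, F9})) \<in> O(\<lambda>m. real m)"
    \<comment> \<open>For \<open>m \<ge> 1\<close> the additive 1 of the upper bound is at most
      \<open>m\<close>, which raises the factor \<open>2 * t\<close> by one.\<close>
    proof (rule bigoI[where c = "real (2 * t + 1)"])
      have "real (forb m {Q3 t, F9}) \<le> real (2 * t + 1) * real m" if "m \<ge> 1" for m
      proof -
        have "forb m {Q3 t, F9} \<le> (2 * t + 1) * m"
          using upper[of m] that by (simp add: algebra_simps)
        then show ?thesis unfolding of_nat_mult[symmetric] by (rule of_nat_mono)
      qed
      then show "\<forall>\<^sub>F m in at_top. norm (real (forb m {Q3 t, F9})) \<le> real (2 * t + 1) * norm (real m)"
        by (intro eventually_at_top_linorderI[of 1]) simp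
    qed
    show "(\<lambda>m. real (forb m {Q3 t, F9})) \<in> \<Omega>(\<lambda>m. real m)"
      by (rule landau_omega.bigI[where c = 1]) (use lower in auto)
  qed
qed

end
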